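(* Let $\Bbbk$ be a field of characteristic zero and let $a,c\in\Bbbk$ with $ac\neq 1$. In the algebra $Q(a,-1,c)$ the following formulas hold for all $m,n\in\mathbb{N}$: (1) $y^{n}x^{m}=x^{m}y^{n}$, if $m$ is even or $n$ is even. (2) $y^{n}x^{m}=ax^{m+1}y^{n-1}-x^{m}y^{n}+cx^{m-1}y^{n+1}$, if $m$ and $n$ are both odd.
   Context: $\mathbb{N}$ includes $0$. For $a,b,c\in\Bbbk$, $Q(a,b,c)$ denotes the associative unital $\Bbbk$-algebra generated by $x,y$ subject to the single relation $yx=ax^{2}+bxy+cy^{2}$. Thus in $Q(a,-1,c)$ the relation is $yx=ax^2-xy+cy^2$. When $ac\ne 1$ the set $\{x^{i}y^{j}\mid i,j\in\mathbb{N}\}$ is a $\Bbbk$-basis (PBW basis) of $Q(a,-1,c)$. *)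

theory Defs
  imports "HOL-Algebra.QuotRing" "HOL-Algebra.Module" "HOL-Library.Poly_Mapping"
begin

datatype letter = X | Y

text \<open>
  The free monoid on two letters. Concatenation of words is written additively, although it is not
  commutative, because the convolution product on \<^type>\<open>poly_mapping\<close> expects an additive
  monoid of exponents.
\<close>

datatype word = Word (letters: "letter list")

instantiation word :: monoid_add
begin

definition zero_word :: word where
  "0 = Word []"

definition plus_word :: "word \<Rightarrow> word \<Rightarrow> word" where
  "u + v = Word (letters u @ letters v)"

instance
  by standard (simp_all add: zero_word_def plus_word_def)

end

text \<open>The free associative unital algebra on the two letters: its monoid algebra of words.\<close>

definition free_algebra :: "('k::field, word \<Rightarrow>\<^sub>0 'k) module" where
  "free_algebra =
    \<lparr>carrier = UNIV, mult = (*), one = 1, zero = 0, add = (+),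
     smult = (\<lambda>r p. Poly_Mapping.single 0 r * p)\<rparr>"

abbreviation gen :: "letter \<Rightarrow> word \<Rightarrow>\<^sub>0 'k::field" where
  "gen l \<equiv> Poly_Mapping.single (Word [l]) 1"

text \<open>
  The quotient of an algebra by a two-sided ideal. The ring structure is that of \<^const>\<open>FactRing\<close>,
  to which the induced scalar multiplication is added.
\<close>

definition quot_algebra :: "('k, 'a) module \<Rightarrow> 'a set \<Rightarrow> ('k, 'a set) module" where
  "quot_algebra A I =
    ring.extend (A Quot I)
      (module.fields (\<lambda>r C. \<Union>p\<in>C. I +>\<^bsub>A\<^esub> (r \<odot>\<^bsub>A\<^esub> p)))"

definition Q_relator :: "'k::field \<Rightarrow> 'k \<Rightarrow> 'k \<Rightarrow> word \<Rightarrow>\<^sub>0 'k" where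
  "Q_relator a b c =
    gen Y \<otimes>\<^bsub>free_algebra\<^esub> gen X \<ominus>\<^bsub>free_algebra\<^esub>
      (a \<odot>\<^bsub>free_algebra\<^esub> (gen X [^]\<^bsub>free_algebra\<^esub> (2::nat)) \<oplus>\<^bsub>free_algebra\<^esub>
       b \<odot>\<^bsub>free_algebra\<^esub> (gen X \<otimes>\<^bsub>free_algebra\<^esub> gen Y) \<oplus>\<^bsub>free_algebra\<^esub>
       c \<odot>\<^bsub>free_algebra\<^esub> (gen Y [^]\<^bsub>free_algebra\<^esub> (2::nat)))"

definition Q_ideal :: "'k::field \<Rightarrow> 'k \<Rightarrow> 'k \<Rightarrow> (word \<Rightarrow>\<^sub>0 'k) set" where
  "Q_ideal a b c = Idl\<^bsub>free_algebra\<^esub> {Q_relator a b c}"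

definition Q :: "'k::field \<Rightarrow> 'k \<Rightarrow> 'k \<Rightarrow> ('k, (word \<Rightarrow>\<^sub>0 'k) set) module" where
  "Q a b c = quot_algebra free_algebra (Q_ideal a b c)"

definition Q_gen :: "'k::field \<Rightarrow> 'k \<Rightarrow> 'k \<Rightarrow> letter \<Rightarrow> (word \<Rightarrow>\<^sub>0 'k) set" where
  "Q_gen a b c l = Q_ideal a b c +>\<^bsub>free_algebra\<^esub> gen l"

end

theory Submission
  imports Defs
begin

text \<open>Modulo the relation, x^2 commutes with y and y^2 commutes with x: the commutators of the
  relator with x and with y give two linear equations for [x^2, y] and [x, y^2], and since ac
  differs from 1 both must vanish (\<open>squares_commute\<close>). Hence an even power of one
  generator commutes with every power of the other, which is (1)
  (\<open>power_commute_even\<close>). For (2), one y and one x are split off; a single use of the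
  relation rewrites yx between two even powers, which then move freely
  (\<open>power_commute_odd\<close>). The computation is done with congruences modulo a two-sided
  ideal of an arbitrary ring; \<open>quadratic_relation_Q_ideal\<close> and
  \<open>quot_free_algebra_coset\<close> carry it over to the cosets that make up
  \<open>Q\<close>.\<close>

locale two_sided_ideal =
  fixes J :: "'r::ring_1 set"
  assumes zero_mem: "0 \<in> J"
    and add_mem: "\<And>p q. p \<in> J \<Longrightarrow> q \<in> J \<Longrightarrow> p + q \<in> J"
    and mult_left_mem: "\<And>p q. p \<in> J \<Longrightarrow> q * p \<in> J"
    and mult_right_mem: "\<And>p q. p \<in> J \<Longrightarrow> p * q \<in> J"
begin

text \<open>Congruence of representatives replaces equality of cosets, so that all calculations stay
  in a type-class ring.\<close>

definition eqv :: "'r \<Rightarrow> 'r \<Rightarrow> bool" (infix "\<approx>" 50) where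
  "p \<approx> q \<longleftrightarrow> p - q \<in> J"

lemma uminus_mem: "p \<in> J \<Longrightarrow> - p \<in> J"
  using mult_left_mem[of p "- 1"] by simp

lemma diff_mem: "p \<in> J \<Longrightarrow> q \<in> J \<Longrightarrow> p - q \<in> J"
  using add_mem[of p "- q"] uminus_mem by simp

lemma eqv_refl: "p \<approx> p"
  by (simp add: eqv_def zero_mem)

lemma eqv_sym: "p \<approx> q \<Longrightarrow> q \<approx> p"
  using uminus_mem[of "p - q"] by (simp add: eqv_def)

lemma eqv_trans [trans]: "p \<approx> q \<Longrightarrow> q \<approx> s \<Longrightarrow> p \<approx> s"
  using add_mem[of "p - q" "q - s"] by (simp add: eqv_def)

lemma eqv_add: "p \<approx> q \<Longrightarrow> p' \<approx> q' \<Longrightarrow> p + p' \<approx> q + q'"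
  using add_mem[of "p - q" "p' - q'"] by (simp add: eqv_def algebra_simps)

lemma eqv_diff: "p \<approx> q \<Longrightarrow> p' \<approx> q' \<Longrightarrow> p - p' \<approx> q - q'"
  using diff_mem[of "p - q" "p' - q'"] by (simp add: eqv_def algebra_simps)

lemma eqv_mult:
  assumes "p \<approx> q" "p' \<approx> q'"
  shows "p * p' \<approx> q * q'"
proof -
  have "p * p' - q * q' = (p - q) * p' + q * (p' - q')"
    by (simp add: algebra_simps)
  then show ?thesis
    using assms add_mem mult_left_mem mult_right_mem by (metis eqv_def)
qed

lemma commute_power_left:
  assumes "p * q \<approx> q * p"
  shows "p ^ n * q \<approx> q * p ^ n"
proof (induction n)
  case 0
  show ?case by (simp add: eqv_refl)
next
  case (Suc n)
  have "p ^ Suc n * q = p * (p ^ n * q)" by (simp add: mult.assoc)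
  also have "\<dots> \<approx> p * (q * p ^ n)" by (intro eqv_mult eqv_refl Suc)
  also have "\<dots> = (p * q) * p ^ n" by (simp add: mult.assoc)
  also have "\<dots> \<approx> (q * p) * p ^ n" by (intro eqv_mult eqv_refl assms)
  also have "\<dots> = q * p ^ Suc n" by (simp add: mult.assoc)
  finally show ?case .
qed

lemma commute_power_power:
  assumes "p * q \<approx> q * p"
  shows "p ^ n * q ^ m \<approx> q ^ m * p ^ n"
  using commute_power_left[OF eqv_sym[OF commute_power_left[OF assms]]] by (rule eqv_sym)

end

text \<open>The scalars a and c appear as central ring elements, since the ring here has no scalar
  multiplication; \<open>unit\<close> is the form that ac \<noteq> 1 takes in this setting.\<close>

locale quadratic_relation = two_sided_ideal J for J :: "'r::ring_1 set" +
  fixes a c x y :: 'r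
  assumes central_a: "\<And>p. p * a = a * p"
    and central_c: "\<And>p. p * c = c * p"
    and unit: "\<exists>u. u * (1 - a * c) = 1"
    and relation: "y * x \<approx> a * x\<^sup>2 - x * y + c * y\<^sup>2"
begin

text \<open>
  With \<open>r = y x - a x\<^sup>2 + x y - c y\<^sup>2\<close>, the commutators satisfy
  \<open>[x, r] = [x\<^sup>2, y] - c [x, y\<^sup>2]\<close> and \<open>[y, r] = a [x\<^sup>2, y] - [x, y\<^sup>2]\<close>,
  a linear system with determinant \<open>a c - 1\<close>.
\<close>

lemma squares_commute:
  shows x_square_commute: "x\<^sup>2 * y \<approx> y * x\<^sup>2"
    and y_square_commute: "y\<^sup>2 * x \<approx> x * y\<^sup>2"
proof -
  define r where "r = y * x - (a * x\<^sup>2 - x * y + c * y\<^sup>2)"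
  have r: "r \<in> J" using relation by (simp add: r_def eqv_def)
  obtain u where u: "u * (1 - a * c) = 1" using unit by blast
  have shift: "p * (a * q) = a * (p * q)" "p * (c * q) = c * (p * q)" for p q
    by (metis central_a mult.assoc, metis central_c mult.assoc)
  have xr: "x * r - r * x = (x\<^sup>2 * y - y * x\<^sup>2) - c * (x * y\<^sup>2 - y\<^sup>2 * x)"
    and yr: "y * r - r * y = a * (x\<^sup>2 * y - y * x\<^sup>2) - (x * y\<^sup>2 - y\<^sup>2 * x)"
    by (simp_all add: r_def algebra_simps power2_eq_square shift[of x] shift[of y])
  have yr_mem: "y * r - r * y \<in> J" and xr_mem: "x * r - r * x \<in> J"
    by (simp_all add: r diff_mem mult_left_mem mult_right_mem)
  \<comment> \<open>Subtracting c times the second equation from the first eliminates [x, y^2]; the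
    factor 1 - ac that remains is then cancelled by u.\<close>
  have "(1 - a * c) * (x\<^sup>2 * y - y * x\<^sup>2) = (x * r - r * x) - c * (y * r - r * y)"
    by (simp add: xr yr algebra_simps shift(2)[of a])
  then have "u * ((1 - a * c) * (x\<^sup>2 * y - y * x\<^sup>2)) \<in> J"
    using xr_mem yr_mem by (simp add: diff_mem mult_left_mem)
  then have x2: "x\<^sup>2 * y - y * x\<^sup>2 \<in> J"
    by (metis u mult.assoc mult_1)
  then show "x\<^sup>2 * y \<approx> y * x\<^sup>2" by (simp add: eqv_def)
  have "y\<^sup>2 * x - x * y\<^sup>2 = (y * r - r * y) - a * (x\<^sup>2 * y - y * x\<^sup>2)"
    by (simp add: yr)
  then show "y\<^sup>2 * x \<approx> x * y\<^sup>2"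
    using yr_mem x2 by (simp add: eqv_def diff_mem mult_left_mem)
qed

text \<open>One even exponent suffices: it gives a power of a square, and that square commutes with
  the other generator and so with all its powers.\<close>

lemma power_commute_even:
  assumes "even m \<or> even n"
  shows "y ^ n * x ^ m \<approx> x ^ m * y ^ n"
  using assms
proof
  assume "even m"
  then obtain i where "m = 2 * i" by (elim evenE)
  then show ?thesis
    using commute_power_power[OF eqv_sym[OF x_square_commute]] by (simp add: power_mult)
next
  assume "even n"
  then obtain j where "n = 2 * j" by (elim evenE)
  then show ?thesis
    using commute_power_power[OF y_square_commute] by (simp add: power_mult)
qed

text \<open>The outer factors \<open>y ^ (2 * j)\<close> and \<open>x ^ (2 * i)\<close> are even
  powers, so the relation is needed only once, for the yx between them. Oddness keeps the
  subtractions \<open>m - 1\<close> and \<open>n - 1\<close> from truncating.\<close>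

lemma power_commute_odd:
  assumes "odd m" "odd n"
  shows "y ^ n * x ^ m \<approx>
    a * (x ^ (m + 1) * y ^ (n - 1)) - x ^ m * y ^ n + c * (x ^ (m - 1) * y ^ (n + 1))"
proof -
  obtain i j where m: "m = 2 * i + 1" and n: "n = 2 * j + 1"
    using assms by (elim oddE)
  have shift: "p * (a * q) = a * (p * q)" "p * (c * q) = c * (p * q)" for p q
    by (metis central_a mult.assoc, metis central_c mult.assoc)
  let ?X = "x ^ (2 * i)" and ?Y = "y ^ (2 * j)"
  have "y ^ n * x ^ m = ?Y * (y * x) * ?X"
    by (simp add: m n mult.assoc power_Suc2 del: power_Suc)
      (simp add: mult.assoc flip: power_Suc power_Suc2)
  also have "\<dots> \<approx> ?Y * (a * x\<^sup>2 - x * y + c * y\<^sup>2) * ?X"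
    by (intro eqv_mult eqv_refl relation)
  also have "\<dots> = a * (?Y * x ^ (m + 1)) - (?Y * x) * (y * ?X) + c * (y ^ (n + 1) * ?X)"
  proof -
    have "x ^ (m + 1) = x\<^sup>2 * ?X" "y ^ (n + 1) = ?Y * y\<^sup>2"
      unfolding power_add[symmetric] by (simp_all add: m n)
    then show ?thesis by (simp add: algebra_simps shift[of "y ^ (j * 2)"])
  qed
  \<comment> \<open>Each of the four swaps involves an even exponent; in the middle term,
    \<open>?Y\<close> passes a single x and \<open>?X\<close> passes a single y.\<close>
  also have "\<dots> \<approx> a * (x ^ (m + 1) * ?Y) - (x * ?Y) * (?X * y) + c * (?X * y ^ (n + 1))"
    using power_commute_even[of 1 "2 * j"] power_commute_even[of "2 * i" 1]
      power_commute_even[of "m + 1" "2 * j"] power_commute_even[of "2 * i" "n + 1"]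
    by (intro eqv_add eqv_diff eqv_mult[of a] eqv_mult[of c] eqv_mult[of "?Y * x"] eqv_refl)
      (simp_all add: n)
  also have "(x * ?Y) * (?X * y) = x * (?Y * ?X) * y" by (simp add: mult.assoc)
  also have "a * (x ^ (m + 1) * ?Y) - x * (?Y * ?X) * y + c * (?X * y ^ (n + 1)) \<approx>
      a * (x ^ (m + 1) * ?Y) - x * (?X * ?Y) * y + c * (?X * y ^ (n + 1))"
    using power_commute_even[of "2 * i" "2 * j"]
    by (intro eqv_add eqv_diff eqv_refl eqv_mult[of _ _ y y] eqv_mult[of x x]) simp_all
  also have "x * (?X * ?Y) * y = x ^ m * y ^ n"
    by (simp add: m n mult.assoc power_commutes)
  finally show ?thesis by (simp add: m n)
qed

end

text \<open>Words do not commute, but the empty word is neutral on both sides, so scalars embedded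
  at exponent 0 are central. It suffices to check this on monomials.\<close>

lemma single_zero_commute:
  fixes p :: "'a::monoid_add \<Rightarrow>\<^sub>0 'k::comm_semiring_1"
  shows "p * Poly_Mapping.single 0 r = Poly_Mapping.single 0 r * p"
proof (induction p rule: Poly_Mapping.update_induct)
  case const
  show ?case by simp
next
  case (update f k v)
  \<comment> \<open>The key is fresh, so the update adds a monomial.\<close>
  have "Poly_Mapping.update k v f = Poly_Mapping.single k v + f"
    using update(1)
    by (intro poly_mapping_eqI)
      (auto simp: lookup_update lookup_add lookup_single when_def in_keys_iff)
  with update(3) show ?case
    by (simp add: distrib_left distrib_right mult_single mult.commute)
qed

lemma free_algebra_sel [simp]:
  "carrier free_algebra = UNIV"
  "p \<otimes>\<^bsub>free_algebra\<^esub> q = p * q"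
  "\<one>\<^bsub>free_algebra\<^esub> = 1"
  "\<zero>\<^bsub>free_algebra\<^esub> = 0"
  "p \<oplus>\<^bsub>free_algebra\<^esub> q = p + q"
  "r \<odot>\<^bsub>free_algebra\<^esub> p = Poly_Mapping.single 0 r * p"
  by (simp_all add: free_algebra_def)

lemma ring_free_algebra: "ring free_algebra"
proof (intro ringI abelian_groupI monoidI)
  fix p :: "word \<Rightarrow>\<^sub>0 'k::field"
  show "\<exists>q\<in>carrier free_algebra. q \<oplus>\<^bsub>free_algebra\<^esub> p = \<zero>\<^bsub>free_algebra\<^esub>"
    by (intro bexI[of _ "- p"]) simp_all
qed (simp_all add: algebra_simps)

lemma free_algebra_pow [simp]: "p [^]\<^bsub>free_algebra\<^esub> (n::nat) = p ^ n"
  by (induction n) (simp_all add: nat_pow_def power_commutes)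

lemma free_algebra_a_inv [simp]: "\<ominus>\<^bsub>free_algebra\<^esub> p = - p"
proof -
  interpret ring "free_algebra :: ('k::field, word \<Rightarrow>\<^sub>0 'k) module"
    by (rule ring_free_algebra)
  show ?thesis using minus_equality[of "- p" p] by simp
qed

lemma free_algebra_minus [simp]: "p \<ominus>\<^bsub>free_algebra\<^esub> q = p - q"
  by (simp add: a_minus_def)

lemma two_sided_ideal_free_algebra:
  assumes "ideal I free_algebra"
  shows "two_sided_ideal I"
proof -
  interpret ideal I free_algebra by (rule assms)
  show ?thesis
    using additive_subgroup.zero_closed[OF is_additive_subgroup]
      additive_subgroup.a_closed[OF is_additive_subgroup] I_l_closed I_r_closed
    by unfold_locales auto
qed

lemma free_algebra_coset_eq_iff:
  assumes "ideal I free_algebra"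
  shows "I +>\<^bsub>free_algebra\<^esub> p = I +>\<^bsub>free_algebra\<^esub> q \<longleftrightarrow> p - q \<in> I"
  using ring.quotient_eq_iff_same_a_r_cos[OF ring_free_algebra assms, of p q] by auto

lemma quot_algebra_sel:
  "carrier (quot_algebra A I) = carrier (A Quot I)"
  "mult (quot_algebra A I) = mult (A Quot I)"
  "one (quot_algebra A I) = one (A Quot I)"
  "zero (quot_algebra A I) = zero (A Quot I)"
  "add (quot_algebra A I) = add (A Quot I)"
  "r \<odot>\<^bsub>quot_algebra A I\<^esub> C = (\<Union>p\<in>C. I +>\<^bsub>A\<^esub> (r \<odot>\<^bsub>A\<^esub> p))"
  by (simp_all add: quot_algebra_def ring.defs module.defs)

text \<open>Subtraction is derived from record fields that both structures share.\<close>

lemma quot_algebra_minus: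
  "C \<ominus>\<^bsub>quot_algebra A I\<^esub> D = C \<ominus>\<^bsub>A Quot I\<^esub> D"
  by (simp add: a_minus_def a_inv_def m_inv_def quot_algebra_sel)

lemma quot_algebra_pow:
  "C [^]\<^bsub>quot_algebra A I\<^esub> (n::nat) = C [^]\<^bsub>A Quot I\<^esub> n"
  by (simp add: nat_pow_def quot_algebra_sel)

context
  fixes I :: "(word \<Rightarrow>\<^sub>0 'k::field) set"
  assumes ideal: "ideal I free_algebra"
begin

interpretation hom: ring_hom_ring free_algebra "free_algebra Quot I" "(+>\<^bsub>free_algebra\<^esub>) I"
  by (rule ideal.rcos_ring_hom_ring[OF ideal])

interpretation two_sided_ideal I
  by (rule two_sided_ideal_free_algebra[OF ideal])

lemma quot_free_algebra_coset:
  fixes p q :: "word \<Rightarrow>\<^sub>0 'k"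
  shows "(I +>\<^bsub>free_algebra\<^esub> p) \<otimes>\<^bsub>quot_algebra free_algebra I\<^esub> (I +>\<^bsub>free_algebra\<^esub> q)
      = I +>\<^bsub>free_algebra\<^esub> (p * q)"
    and "(I +>\<^bsub>free_algebra\<^esub> p) \<oplus>\<^bsub>quot_algebra free_algebra I\<^esub> (I +>\<^bsub>free_algebra\<^esub> q)
      = I +>\<^bsub>free_algebra\<^esub> (p + q)"
    and "(I +>\<^bsub>free_algebra\<^esub> p) \<ominus>\<^bsub>quot_algebra free_algebra I\<^esub> (I +>\<^bsub>free_algebra\<^esub> q)
      = I +>\<^bsub>free_algebra\<^esub> (p - q)"
    and "(I +>\<^bsub>free_algebra\<^esub> p) [^]\<^bsub>quot_algebra free_algebra I\<^esub> (n::nat)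
      = I +>\<^bsub>free_algebra\<^esub> (p ^ n)"
    and "r \<odot>\<^bsub>quot_algebra free_algebra I\<^esub> (I +>\<^bsub>free_algebra\<^esub> p)
      = I +>\<^bsub>free_algebra\<^esub> (Poly_Mapping.single 0 r * p)"
proof -
  show "(I +>\<^bsub>free_algebra\<^esub> p) \<otimes>\<^bsub>quot_algebra free_algebra I\<^esub> (I +>\<^bsub>free_algebra\<^esub> q)
      = I +>\<^bsub>free_algebra\<^esub> (p * q)"
    using hom.hom_mult[of p q] by (simp add: quot_algebra_sel)
  show "(I +>\<^bsub>free_algebra\<^esub> p) \<oplus>\<^bsub>quot_algebra free_algebra I\<^esub> (I +>\<^bsub>free_algebra\<^esub> q)
      = I +>\<^bsub>free_algebra\<^esub> (p + q)"
    using hom.hom_add[of p q] by (simp add: quot_algebra_sel)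
  show "(I +>\<^bsub>free_algebra\<^esub> p) \<ominus>\<^bsub>quot_algebra free_algebra I\<^esub> (I +>\<^bsub>free_algebra\<^esub> q)
      = I +>\<^bsub>free_algebra\<^esub> (p - q)"
    using hom.hom_add[of p "- q"] hom.hom_a_inv[of q]
    unfolding quot_algebra_minus by (simp add: a_minus_def)
  show "(I +>\<^bsub>free_algebra\<^esub> p) [^]\<^bsub>quot_algebra free_algebra I\<^esub> (n::nat)
      = I +>\<^bsub>free_algebra\<^esub> (p ^ n)"
    using hom.hom_nat_pow[of p n] by (simp add: quot_algebra_pow)
  \<comment> \<open>The scalar multiple is a union over representatives. The family is nonempty, as
    it contains p, and constant, as the ideal absorbs left multiplication by the scalar; so the
    union is that one coset.\<close>
  have "p \<in> I +>\<^bsub>free_algebra\<^esub> p"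
    using zero_mem by (auto simp: a_r_coset_def' intro!: bexI[of _ 0])
  moreover have "I +>\<^bsub>free_algebra\<^esub> (Poly_Mapping.single 0 r * p')
      = I +>\<^bsub>free_algebra\<^esub> (Poly_Mapping.single 0 r * p)"
    if "p' \<in> I +>\<^bsub>free_algebra\<^esub> p" for p'
  proof -
    have "p' - p \<in> I"
      using that by (auto simp: a_r_coset_def')
    then show ?thesis
      by (simp add: free_algebra_coset_eq_iff[OF ideal] mult_left_mem flip: right_diff_distrib)
  qed
  ultimately show "r \<odot>\<^bsub>quot_algebra free_algebra I\<^esub> (I +>\<^bsub>free_algebra\<^esub> p)
      = I +>\<^bsub>free_algebra\<^esub> (Poly_Mapping.single 0 r * p)"
    unfolding quot_algebra_sel free_algebra_sel by (intro SUP_eq_const) blast+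
qed

end

lemma ideal_Q_ideal: "ideal (Q_ideal a b c) free_algebra"
  unfolding Q_ideal_def by (rule ring.genideal_ideal[OF ring_free_algebra]) simp

lemma quadratic_relation_Q_ideal:
  fixes a c :: "'k::field"
  assumes "a * c \<noteq> 1"
  shows "quadratic_relation (Q_ideal a (-1) c) (Poly_Mapping.single 0 a) (Poly_Mapping.single 0 c)
    (gen X) (gen Y)"
proof -
  interpret two_sided_ideal "Q_ideal a (-1) c"
    by (rule two_sided_ideal_free_algebra[OF ideal_Q_ideal])
  \<comment> \<open>Here ac \<noteq> 1 is used: the inverse in the field, embedded as a scalar,
    serves as the witness for \<open>unit\<close>.\<close>
  have "Poly_Mapping.single 0 (inverse (1 - a * c)) *
      (1 - Poly_Mapping.single 0 a * Poly_Mapping.single 0 c) = (1 :: word \<Rightarrow>\<^sub>0 'k)"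
    using assms by (simp add: Poly_Mapping.mult_single flip: single_one single_diff)
  moreover have "Q_relator a (-1) c \<in> Q_ideal a (-1) c"
    unfolding Q_ideal_def by (rule ring.genideal_self'[OF ring_free_algebra]) simp
  ultimately show ?thesis
    by unfold_locales
      (blast intro: single_zero_commute, blast intro: single_zero_commute, blast,
        simp add: eqv_def Q_relator_def single_uminus)
qed

theorem proposition2p1:
  fixes a c :: "'k::field_char_0" and m n :: nat
  assumes "a * c \<noteq> 1"
  shows "let A = Q a (-1) c; x = Q_gen a (-1) c X; y = Q_gen a (-1) c Y in
    (even m \<or> even n \<longrightarrow>
      y [^]\<^bsub>A\<^esub> n \<otimes>\<^bsub>A\<^esub> x [^]\<^bsub>A\<^esub> m = x [^]\<^bsub>A\<^esub> m \<otimes>\<^bsub>A\<^esub> y [^]\<^bsub>A\<^esub> n) \<and>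
    (odd m \<and> odd n \<longrightarrow>
      y [^]\<^bsub>A\<^esub> n \<otimes>\<^bsub>A\<^esub> x [^]\<^bsub>A\<^esub> m =
        a \<odot>\<^bsub>A\<^esub> (x [^]\<^bsub>A\<^esub> (m + 1) \<otimes>\<^bsub>A\<^esub> y [^]\<^bsub>A\<^esub> (n - 1))
        \<ominus>\<^bsub>A\<^esub> x [^]\<^bsub>A\<^esub> m \<otimes>\<^bsub>A\<^esub> y [^]\<^bsub>A\<^esub> n
        \<oplus>\<^bsub>A\<^esub> c \<odot>\<^bsub>A\<^esub> (x [^]\<^bsub>A\<^esub> (m - 1) \<otimes>\<^bsub>A\<^esub> y [^]\<^bsub>A\<^esub> (n + 1)))"
proof -
  interpret quadratic_relation "Q_ideal a (-1) c" "Poly_Mapping.single 0 a" "Poly_Mapping.single 0 c"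
    "gen X" "gen Y"
    using assms by (rule quadratic_relation_Q_ideal)
  \<comment> \<open>These rules collapse each side to a single coset and turn equality of cosets
    into membership of the difference in the ideal, which is \<open>eqv\<close> unfolded.\<close>
  note coset = quot_free_algebra_coset[OF ideal_Q_ideal] free_algebra_coset_eq_iff[OF ideal_Q_ideal]
  show ?thesis
    using power_commute_even[of m n] power_commute_odd[of m n]
    unfolding Let_def Q_def Q_gen_def coset eqv_def by blast
qed

end
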